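(* Let $G=(S\cup K,E)$ be a split graph, where $S$ is an independent set and $K$ is a clique of $G$, and assume $K$ is a maximum clique, i.e. $\omega(G)=|K|$. Then $D(G)=Tr(G)$.
   Context: All graphs are finite and simple. A split graph is a graph whose vertex set can be partitioned into an independent set $S$ and a clique $K$. $\omega(G)$ is the clique number. For disjoint vertex sets $A,B$, $A$ dominates $B$ if every vertex of $B$ is adjacent to at least one vertex of $A$. A transitive $k$-partition is a partition of $V(G)$ into $k$ nonempty parts $V_1,\dots,V_k$ with $V_i$ dominating $V_j$ for all $1\le i<j\le k$; the transitivity $Tr(G)$ is the maximum such $k$. An upper domatic partition of size $k$ is a partition of $V(G)$ into $k$ nonempty parts such that for any two parts $V_i,V_j$, $V_i$ dominates $V_j$ or $V_j$ dominates $V_i$ (or both); the upper domatic number $D(G)$ is the maximum such $k$. *)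

theory Defs
  imports "HOL-Library.Ramsey" "HOL-Library.Disjoint_Sets"
begin

definition simple_graph :: "'a set \<Rightarrow> 'a set set \<Rightarrow> bool" where
  "simple_graph V E \<longleftrightarrow> finite V \<and> E \<subseteq> [V]\<^bsup>2\<^esup>"

text \<open>The predicates \<^const>\<open>clique\<close> and \<^const>\<open>indep\<close> do not restrict their argument
  to the vertex set; that is stated separately below.\<close>

definition clique_number :: "'a set \<Rightarrow> 'a set set \<Rightarrow> nat" where
  "clique_number V E = Max {card C |C. C \<subseteq> V \<and> clique C E}"

definition split_partition :: "'a set \<Rightarrow> 'a set set \<Rightarrow> 'a set \<Rightarrow> 'a set \<Rightarrow> bool" where
  "split_partition V E S K \<longleftrightarrow> V = S \<union> K \<and> S \<inter> K = {} \<and> indep S E \<and> clique K E"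

definition set_dominates :: "'a set set \<Rightarrow> 'a set \<Rightarrow> 'a set \<Rightarrow> bool" where
  "set_dominates E A B \<longleftrightarrow> (\<forall>b\<in>B. \<exists>a\<in>A. {a, b} \<in> E)"

text \<open>The parts are numbered \<open>1, \<dots>, k\<close>; injectivity makes them pairwise distinct, hence
  disjoint. Nonemptiness of the parts is a component of \<^const>\<open>partition_on\<close>.\<close>

definition transitive_partition ::
    "'a set \<Rightarrow> 'a set set \<Rightarrow> nat \<Rightarrow> (nat \<Rightarrow> 'a set) \<Rightarrow> bool" where
  "transitive_partition V E k P \<longleftrightarrow>
     inj_on P {1..k} \<and> partition_on V (P ` {1..k}) \<and>
     (\<forall>i\<in>{1..k}. \<forall>j\<in>{1..k}. i < j \<longrightarrow> set_dominates E (P i) (P j))"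

definition upper_domatic_partition ::
    "'a set \<Rightarrow> 'a set set \<Rightarrow> nat \<Rightarrow> 'a set set \<Rightarrow> bool" where
  "upper_domatic_partition V E k \<P> \<longleftrightarrow>
     partition_on V \<P> \<and> card \<P> = k \<and>
     (\<forall>A\<in>\<P>. \<forall>B\<in>\<P>. A \<noteq> B \<longrightarrow> set_dominates E A B \<or> set_dominates E B A)"

text \<open>For a finite vertex set the maxima below range over finite nonempty sets; on the empty
  graph both numbers are \<open>0\<close>.\<close>

definition transitivity :: "'a set \<Rightarrow> 'a set set \<Rightarrow> nat" where
  "transitivity V E = Max {k. \<exists>P. transitive_partition V E k P}"

definition upper_domatic_number :: "'a set \<Rightarrow> 'a set set \<Rightarrow> nat" where
  "upper_domatic_number V E = Max {k. \<exists>\<P>. upper_domatic_partition V E k \<P>}"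

lemma card_partition_on_le:
  assumes "finite V" "partition_on V \<P>"
  shows "card \<P> \<le> card V"
proof -
  have fin: "finite \<P>"
    using assms finite_elements by blast
  have "card \<P> = (\<Sum>A\<in>\<P>. 1)" by simp
  also have "\<dots> \<le> (\<Sum>A\<in>\<P>. card A)"
  proof (rule sum_mono)
    fix A assume "A \<in> \<P>"
    then have "A \<noteq> {}" "finite A"
      using assms by (auto simp: partition_on_def intro: finite_subset)
    then show "1 \<le> card A" by (simp add: Suc_le_eq card_gt_0_iff)
  qed
  also have "\<dots> = card (\<Union>\<P>)"
    using assms by (intro card_Union_disjoint[symmetric])
      (auto simp: partition_on_def disjoint_def pairwise_def disjnt_def intro: finite_subset)
  finally show ?thesis using assms by (simp add: partition_on_def)
qed

lemma clique_number_wf: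
  assumes "finite V"
  shows "finite {card C |C. C \<subseteq> V \<and> clique C E}" "{card C |C. C \<subseteq> V \<and> clique C E} \<noteq> {}"
proof -
  have "{card C |C. C \<subseteq> V \<and> clique C E} \<subseteq> card ` Pow V" by auto
  then show "finite {card C |C. C \<subseteq> V \<and> clique C E}"
    using assms finite_subset by blast
  show "{card C |C. C \<subseteq> V \<and> clique C E} \<noteq> {}"
    by (auto simp: clique_def intro: exI[of _ "{}"])
qed

lemma transitivity_wf:
  assumes "finite V"
  shows "finite {k. \<exists>P. transitive_partition V E k P}"
    and "{k. \<exists>P. transitive_partition V E k P} \<noteq> {}"
proof -
  have "k \<le> card V" if "transitive_partition V E k P" for k P
    using that card_partition_on_le[OF assms, of "P ` {1..k}"]
    by (simp add: transitive_partition_def card_image)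
  then show "finite {k. \<exists>P. transitive_partition V E k P}"
    by (auto simp: finite_nat_set_iff_bounded_le)
  have "transitive_partition V E (if V = {} then 0 else 1) (\<lambda>_. V)"
    by (auto simp: transitive_partition_def partition_on_def)
  then show "{k. \<exists>P. transitive_partition V E k P} \<noteq> {}" by blast
qed

lemma upper_domatic_number_wf:
  assumes "finite V"
  shows "finite {k. \<exists>\<P>. upper_domatic_partition V E k \<P>}"
    and "{k. \<exists>\<P>. upper_domatic_partition V E k \<P>} \<noteq> {}"
proof -
  show "finite {k. \<exists>\<P>. upper_domatic_partition V E k \<P>}"
    using card_partition_on_le[OF assms]
    by (auto simp: finite_nat_set_iff_bounded_le upper_domatic_partition_def)
  have "upper_domatic_partition V E (card ({V} - {{}})) ({V} - {{}})"
    by (auto simp: upper_domatic_partition_def partition_on_def disjoint_def)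
  then show "{k. \<exists>\<P>. upper_domatic_partition V E k \<P>} \<noteq> {}" by blast
qed

end

theory Submission
  imports Defs
begin

text \<open>At most one part of an upper domatic partition misses \<open>K\<close>, because no edge joins two
  subsets of \<open>S\<close>; hence there are at most \<open>card K + 1\<close> parts. If some part \<open>A\<close> misses \<open>K\<close>, then an
  edge joins \<open>A\<close> to every other part, and its endpoint outside \<open>A\<close> lies in \<open>K\<close>. So \<open>card K + 1\<close>
  parts can only occur if every vertex of \<open>K\<close> has a neighbour in \<open>S\<close>, and in that case \<open>S\<close>
  followed by the singletons of \<open>K\<close> is a transitive partition of this size. Otherwise one moves
  a vertex of \<open>K\<close> into the first part, which gives \<open>card K\<close> parts.\<close>

lemma transitive_partition_imp_upper_domatic:
  assumes "transitive_partition V E k P"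
  shows "upper_domatic_partition V E k (P ` {1..k})"
  unfolding upper_domatic_partition_def
proof (intro conjI ballI impI)
  show "partition_on V (P ` {1..k})" "card (P ` {1..k}) = k"
    using assms by (auto simp: transitive_partition_def card_image)
  fix A B assume "A \<in> P ` {1..k}" "B \<in> P ` {1..k}" "A \<noteq> B"
  then obtain i j where "i \<in> {1..k}" "j \<in> {1..k}" "A = P i" "B = P j" "i < j \<or> j < i"
    by (metis imageE linorder_neqE_nat)
  then show "set_dominates E A B \<or> set_dominates E B A"
    using assms unfolding transitive_partition_def by blast
qed

text \<open>The parts are \<open>A\<close> followed by the singletons of \<open>C\<close> in any
  order: \<open>A\<close> dominates each singleton by assumption, and adjacency inside the clique
  handles two singletons. Applied to \<open>S\<close> and \<open>K\<close>, and to
  \<open>insert x S\<close> and \<open>K - {x}\<close>.\<close>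

lemma transitive_partition_part_and_clique:
  assumes fin: "finite C" and "A \<noteq> {}" "A \<inter> C = {}" "clique C E" "set_dominates E A C"
  shows "\<exists>P. transitive_partition (A \<union> C) E (Suc (card C)) P"
proof -
  obtain h where h: "bij_betw h {1..card C} C"
    using ex_bij_betw_nat_finite_1[OF fin] by blast
  \<comment> \<open>Index 1 is reserved for \<open>A\<close>, so the vertex \<open>h i\<close> sits
    at index \<open>Suc i\<close>.\<close>
  define P where "P i = (if i = 1 then A else {h (i - 1)})" for i :: nat
  have P1: "P 1 = A" and PS: "i \<in> {1..card C} \<Longrightarrow> P (Suc i) = {h i}" for i
    by (auto simp: P_def)
  have range: "{1..Suc (card C)} = insert 1 (Suc ` {1..card C})"
    by (auto simp: image_Suc_atLeastAtMost)
  have hC: "h i \<in> C" if "i \<in> {1..card C}" for i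
    using h that by (auto simp: bij_betw_def)
  have hinj: "h i \<noteq> h j" if "i \<in> {1..card C}" "j \<in> {1..card C}" "i \<noteq> j" for i j
    using inj_onD[OF bij_betw_imp_inj_on[OF h]] that by blast
  have img: "P ` {1..Suc (card C)} = insert A ((\<lambda>c. {c}) ` C)"
  proof -
    have "P ` Suc ` {1..card C} = (\<lambda>c. {c}) ` h ` {1..card C}"
      unfolding image_image by (intro image_cong refl PS)
    then show ?thesis
      unfolding range image_insert P1 bij_betw_imp_surj_on[OF h] by simp
  qed
  have "inj_on P {1..Suc (card C)}"
  proof (rule inj_onI)
    have A_neq: "P (Suc i) \<noteq> A" if "i \<in> {1..card C}" for i
      using PS[OF that] hC[OF that] \<open>A \<inter> C = {}\<close> by auto
    have neq: "P (Suc i) \<noteq> P (Suc j)" if "i \<in> {1..card C}" "j \<in> {1..card C}" "i \<noteq> j" for i j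
      using PS[OF that(1)] PS[OF that(2)] hinj[OF that] by simp
    have cases: "i = 1 \<or> (\<exists>m\<in>{1..card C}. i = Suc m)" if "i \<in> {1..Suc (card C)}" for i
      using that unfolding range by blast
    fix i j assume ij: "i \<in> {1..Suc (card C)}" "j \<in> {1..Suc (card C)}" and "P i = P j"
    then show "i = j"
      using cases[OF ij(1)] cases[OF ij(2)] P1 A_neq neq by metis
  qed
  moreover have "partition_on (A \<union> C) (P ` {1..Suc (card C)})"
    unfolding img using assms by (auto simp: partition_on_def disjoint_def)
  moreover have "set_dominates E (P i) (P j)"
    if ij: "i \<in> {1..Suc (card C)}" "j \<in> {1..Suc (card C)}" "i < j" for i j
  proof -
    \<comment> \<open>As \<open>j > i \<ge> 1\<close>, the dominated part is never \<open>A\<close>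
      but always a singleton.\<close>
    obtain j' where j': "j = Suc j'" "j' \<in> {1..card C}"
      using ij by (cases j) auto
    show ?thesis
    proof (cases "i = 1")
      case True
      then show ?thesis
        using assms(5) j' P1 PS hC by (auto simp: set_dominates_def)
    next
      case False
      then obtain i' where "i = Suc i'" "i' \<in> {1..card C}"
        using ij by (cases i) auto
      then show ?thesis
        using assms(4) ij j' PS hC hinj[of i' j'] by (auto simp: set_dominates_def clique_def)
    qed
  qed
  ultimately show ?thesis
    unfolding transitive_partition_def by blast
qed

text \<open>Choosing a point of \<open>M\<close> in each member is injective by
  disjointness.\<close>

lemma card_disjoint_le_transversal:
  assumes "finite M" "disjoint \<Q>" "\<And>X. X \<in> \<Q> \<Longrightarrow> X \<inter> M \<noteq> {}"
  shows "card \<Q> \<le> card M"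
proof -
  have "\<forall>X\<in>\<Q>. \<exists>x. x \<in> X \<inter> M"
    using assms(3) by blast
  then obtain f where f: "\<And>X. X \<in> \<Q> \<Longrightarrow> f X \<in> X \<inter> M"
    by metis
  have "inj_on f \<Q>"
  proof (rule inj_onI)
    fix X Y assume XY: "X \<in> \<Q>" "Y \<in> \<Q>" "f X = f Y"
    then have "X \<inter> Y \<noteq> {}"
      using f[of X] f[of Y] by auto
    then show "X = Y"
      using XY assms(2) unfolding disjoint_def by blast
  qed
  then show ?thesis
    using f assms(1) by (intro card_inj_on_le) auto
qed

text \<open>A vertex of \<open>B\<close> would have a neighbour in \<open>A\<close>, giving an edge
  inside \<open>S\<close>. Its ends are distinct because edges have two elements;
  \<open>indep\<close> only excludes edges between distinct vertices.\<close>

lemma indep_parts_not_dominating: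
  assumes "E \<subseteq> [V]\<^bsup>2\<^esup>" "indep S E" "A \<subseteq> S" "B \<subseteq> S" "B \<noteq> {}"
  shows "\<not> set_dominates E A B"
proof
  assume "set_dominates E A B"
  then obtain a b where ab: "a \<in> A" "b \<in> B" "{a, b} \<in> E"
    using assms(5) unfolding set_dominates_def by blast
  then have "a \<noteq> b"
    using assms(1) by (auto simp: nsets_def)
  then show False
    using ab assms(2-4) unfolding indep_def by blast
qed

text \<open>Every part other than \<open>A\<close> contains a vertex of \<open>K\<close> with a
  neighbour in \<open>S\<close>; the \<open>Suc\<close> accounts for \<open>A\<close>
  itself.\<close>

lemma upper_domatic_card_le:
  assumes "simple_graph V E" "split_partition V E S K"
    and ud: "upper_domatic_partition V E k \<P>"
    and A: "A \<in> \<P>" "A \<inter> K = {}"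
  shows "k \<le> Suc (card {x \<in> K. \<exists>s\<in>S. {s, x} \<in> E})"
proof -
  let ?M = "{x \<in> K. \<exists>s\<in>S. {s, x} \<in> E}"
  have E: "E \<subseteq> [V]\<^bsup>2\<^esup>" and S: "indep S E" and V: "V = S \<union> K" and "finite ?M" "finite V"
    using assms(1,2) by (auto simp: simple_graph_def split_partition_def intro: finite_subset)
  have part: "partition_on V \<P>" and k: "card \<P> = k"
    and dom: "\<And>X. X \<in> \<P> \<Longrightarrow> X \<noteq> A \<Longrightarrow> set_dominates E A X \<or> set_dominates E X A"
    using ud A by (auto simp: upper_domatic_partition_def)
  have sub: "X \<subseteq> V" "X \<noteq> {}" if "X \<in> \<P>" for X
    using part that by (auto simp: partition_on_def)
  have AS: "A \<subseteq> S"
    using A sub V by blast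
  have "X \<inter> ?M \<noteq> {}" if X: "X \<in> \<P> - {A}" for X
  proof -
    have "\<not> X \<subseteq> S"
      using indep_parts_not_dominating[OF E S AS _ sub(2), of X]
        indep_parts_not_dominating[OF E S _ AS sub(2), of X] A X dom[of X] by blast
    from dom[of X] X consider "set_dominates E A X" | "set_dominates E X A" by blast
    then show ?thesis
    proof cases
      case 1
      \<comment> \<open>Any vertex of \<open>X\<close> in \<open>K\<close> will do: its neighbour in
        \<open>A\<close> lies in \<open>S\<close>.\<close>
      obtain x where "x \<in> X" "x \<in> K"
        using \<open>\<not> X \<subseteq> S\<close> sub(1)[of X] X V by blast
      with 1 AS show ?thesis
        unfolding set_dominates_def by blast
    next
      case 2
      \<comment> \<open>Some vertex of \<open>A\<close> has no neighbour in
        \<open>X \<inter> S\<close>, so its neighbour in \<open>X\<close> must lie in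
        \<open>K\<close>.\<close>
      have "\<not> set_dominates E (X \<inter> S) A"
        by (rule indep_parts_not_dominating[OF E S _ AS sub(2)[OF A(1)]]) simp
      with 2 obtain a x where ax: "a \<in> A" "x \<in> X" "{x, a} \<in> E" "x \<notin> S"
        unfolding set_dominates_def by blast
      then have "x \<in> K"
        using sub(1)[of X] X V by blast
      moreover have "{a, x} \<in> E"
        using ax(3) by (simp add: insert_commute)
      ultimately show ?thesis
        using ax AS by blast
    qed
  qed
  then have "card (\<P> - {A}) \<le> card ?M"
    using part \<open>finite ?M\<close>
    by (intro card_disjoint_le_transversal) (auto simp: partition_on_def disjoint_def)
  moreover have "finite \<P>"
    using finite_elements[OF \<open>finite V\<close> part] .
  ultimately show ?thesis
    using k A(1) by simp
qed

lemma upper_domatic_le_transitive: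
  assumes "simple_graph V E" "split_partition V E S K" "upper_domatic_partition V E k \<P>"
  shows "\<exists>l\<ge>k. \<exists>P. transitive_partition V E l P"
proof -
  have V: "V = S \<union> K" "S \<inter> K = {}" and K: "clique K E" "finite K"
    using assms(1,2) by (auto simp: simple_graph_def split_partition_def)
  have part: "partition_on V \<P>" and k: "card \<P> = k"
    using assms(3) by (auto simp: upper_domatic_partition_def)
  show ?thesis
  proof (cases "k \<le> card K")
    case True
    show ?thesis
    \<comment> \<open>With \<open>K\<close> empty there is no vertex to move, but then
      \<open>k = 0\<close> and any transitive partition suffices.\<close>
    proof (cases "K = {}")
      case True
      then show ?thesis
        using \<open>k \<le> card K\<close> transitivity_wf(2)[of V E] assms(1)
        by (auto simp: simple_graph_def)
    next
      case False
      then obtain x where x: "x \<in> K" by blast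
      \<comment> \<open>The moved vertex \<open>x\<close> alone dominates \<open>K - {x}\<close> and
        keeps the first part nonempty even if \<open>S\<close> is empty.\<close>
      have "\<exists>P. transitive_partition (insert x S \<union> (K - {x})) E (Suc (card (K - {x}))) P"
        using x K V
        by (intro transitive_partition_part_and_clique) (auto simp: set_dominates_def clique_def)
      moreover have "insert x S \<union> (K - {x}) = V" "Suc (card (K - {x})) = card K"
        using x V card_Suc_Diff1[OF K(2) x] by (blast, simp only:)
      ultimately show ?thesis
        using True by auto
    qed
  next
    case False
    have "\<exists>A\<in>\<P>. A \<inter> K = {}"
      using card_disjoint_le_transversal[OF \<open>finite K\<close>, of \<P>] False part k
      by (auto simp: partition_on_def)
    then obtain A where A: "A \<in> \<P>" "A \<inter> K = {}" by blast
    let ?M = "{x \<in> K. \<exists>s\<in>S. {s, x} \<in> E}"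
    have le: "k \<le> Suc (card ?M)"
      using upper_domatic_card_le[OF assms A] .
    \<comment> \<open>Here \<open>card K < k \<le> Suc (card ?M)\<close> forces
      \<open>card K \<le> card ?M\<close>, while \<open>?M \<subseteq> K\<close>.\<close>
    then have "?M = K"
      using False K by (intro card_seteq) auto
    then have "set_dominates E S K"
      unfolding set_dominates_def by blast
    \<comment> \<open>Domination of \<open>K\<close> by \<open>S\<close> is vacuous for empty
      \<open>K\<close>, so nonemptiness is taken from \<open>A\<close>, a part outside
      \<open>K\<close>.\<close>
    moreover have "S \<noteq> {}"
    proof
      assume "S = {}"
      then have "A \<subseteq> K"
        using A(1) V(1) partition_onD1[OF part] by blast
      then show False
        using A partition_onD3[OF part] by (simp add: inf.absorb1)
    qed
    ultimately have "\<exists>P. transitive_partition (S \<union> K) E (Suc (card K)) P"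
      using transitive_partition_part_and_clique[OF K(2) _ V(2) K(1)] by simp
    then show ?thesis
      unfolding V(1) using le unfolding \<open>?M = K\<close> by blast
  qed
qed

theorem theorem3:
  fixes V S K :: "'a set" and E :: "'a set set"
  assumes "simple_graph V E"
    and "split_partition V E S K"
    and "clique_number V E = card K"
  shows "upper_domatic_number V E = transitivity V E"
proof -
  have "finite V"
    using assms(1) by (simp add: simple_graph_def)
  note wf = transitivity_wf[OF this, of E] upper_domatic_number_wf[OF this, of E]
  show ?thesis
  proof (rule antisym)
    show "upper_domatic_number V E \<le> transitivity V E"
      unfolding upper_domatic_number_def transitivity_def
    proof (rule Max.boundedI[OF wf(3,4)])
      fix k assume "k \<in> {k. \<exists>\<P>. upper_domatic_partition V E k \<P>}"
      then obtain l where "k \<le> l" "l \<in> {k. \<exists>P. transitive_partition V E k P}"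
        using upper_domatic_le_transitive[OF assms(1,2)] by blast
      then show "k \<le> Max {k. \<exists>P. transitive_partition V E k P}"
        using Max_ge[OF wf(1)] le_trans by blast
    qed
    show "transitivity V E \<le> upper_domatic_number V E"
      unfolding upper_domatic_number_def transitivity_def
      using transitive_partition_imp_upper_domatic by (intro Max_mono wf) blast
  qed
qed

end
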